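(* Let $\kappa$ be an infinite cardinal and $D$ a tournament with $|V(D)|=\kappa$, $V=V(D)$. Then $V$ can be partitioned into pieces $\{V_x: x\in\Gamma\}$, where $(\Gamma,\vartriangleleft)$ is a linear order, such that (1) for each $x\in\Gamma$, $D\upharpoonright V_x$ is $\kappa$-uniform, i.e. $|(N^+(v)\,\Delta\, N^+(v'))\cap V_x|<\kappa$ and $|(N^-(v)\,\Delta\, N^-(v'))\cap V_x|<\kappa$ for all $v,v'\in V_x$; and (2) every arc $uv$ of $D$ with $u\in V_y$, $v\in V_x$ and $x\vartriangleleft y$ is $\kappa$-reversible in $D$.
   Context: A tournament is a digraph (no loops) in which for all distinct $u,v$ exactly one of $uv$, $vu$ is an arc. $N^+(v)$ and $N^-(v)$ denote the out- and in-neighbourhoods of $v$ in $D$, $\Delta$ denotes symmetric difference, and $D\upharpoonright A$ is the induced subdigraph on $A$. An arc $uv$ of $D$ is $\kappa$-reversible if there are $\kappa$ many pairwise edge-disjoint directed paths from $v$ to $u$ in $D$. *)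

theory Defs
  imports
    "Graph_Theory.Pair_Digraph"
    "Graph_Theory.Digraph_Component"
    "HOL-Library.Disjoint_Sets"
begin

unbundle cardinal_syntax

locale tournament = pair_loopfree_digraph D for D :: "'a pair_pre_digraph" +
  assumes exactly_one_arc:
    "\<lbrakk>u \<in> pverts D; v \<in> pverts D; u \<noteq> v\<rbrakk> \<Longrightarrow> ((u, v) \<in> parcs D) \<noteq> ((v, u) \<in> parcs D)"

definition out_nbhd :: "('a, 'b) pre_digraph \<Rightarrow> 'a \<Rightarrow> 'a set" where
  "out_nbhd D v = {w. v \<rightarrow>\<^bsub>D\<^esub> w}"

definition in_nbhd :: "('a, 'b) pre_digraph \<Rightarrow> 'a \<Rightarrow> 'a set" where
  "in_nbhd D v = {w. w \<rightarrow>\<^bsub>D\<^esub> v}"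

text \<open>Cardinals are represented, as in the library, by cardinal orders \<open>\<kappa>\<close> over an arbitrary type.
  \<open>uniform_on \<kappa> D A\<close> says that the subdigraph of \<open>D\<close> induced by \<open>A\<close> is \<open>\<kappa>\<close>-uniform; the
  neighbourhoods are taken in \<open>D\<close> and then cut down to \<open>A\<close>.\<close>

definition uniform_on :: "'k rel \<Rightarrow> ('a, 'b) pre_digraph \<Rightarrow> 'a set \<Rightarrow> bool" where
  "uniform_on \<kappa> D A \<longleftrightarrow> (\<forall>v\<in>A. \<forall>v'\<in>A.
     |sym_diff (out_nbhd D v) (out_nbhd D v') \<inter> A| <o \<kappa> \<and>
     |sym_diff (in_nbhd D v) (in_nbhd D v') \<inter> A| <o \<kappa>)"

lemma nbhd_induce_subgraph:
  assumes "v \<in> A"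
  shows "out_nbhd (D \<restriction> A) v = out_nbhd D v \<inter> A"
    and "in_nbhd (D \<restriction> A) v = in_nbhd D v \<inter> A"
  using assms
  by (auto simp: out_nbhd_def in_nbhd_def induce_subgraph_def arcs_ends_def arc_to_ends_def)

lemma uniform_on_iff_induce_subgraph:
  fixes A :: "'a set"
  shows "uniform_on \<kappa> D A \<longleftrightarrow> uniform_on \<kappa> (D \<restriction> A) A"
proof -
  have "sym_diff (X \<inter> A) (Y \<inter> A) \<inter> A = sym_diff X Y \<inter> A" for X Y :: "'a set"
    by blast
  then show ?thesis
    unfolding uniform_on_def by (simp add: nbhd_induce_subgraph cong: ball_cong)
qed

text \<open>A path is given by its list of arcs, so paths are edge-disjoint iff the sets of entries of
  these lists are disjoint.\<close>

definition reversible :: "'k rel \<Rightarrow> ('a, 'b) pre_digraph \<Rightarrow> 'a \<Rightarrow> 'a \<Rightarrow> bool" where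
  "reversible \<kappa> D u v \<longleftrightarrow> (\<exists>P. |P| =o \<kappa> \<and> (\<forall>p\<in>P. pre_digraph.apath D v p u) \<and>
     pairwise (\<lambda>p q. set p \<inter> set q = {}) P)"

end

theory Submission
  imports Defs
begin

text \<open>
  Let \<open>R\<close> be the set of arcs that are not \<open>\<kappa>\<close>-reversible. The pieces are the strong components of
  \<open>(V, R)\<close>, linearly ordered by any extension of the partial order induced by \<open>R\<^sup>*\<close>; then a backward
  arc cannot belong to \<open>R\<close>. If \<open>ab \<in> R\<close>, then fewer than \<open>\<kappa>\<close> directed paths of length two lead from
  \<open>b\<close> to \<open>a\<close>, so in a tournament \<open>N\<^sup>-(a) - N\<^sup>-(b)\<close> has size less than \<open>\<kappa>\<close>. This property is inherited
  by \<open>R\<^sup>*\<close>, which makes every strong component \<open>\<kappa>\<close>-uniform.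
\<close>

section \<open>Extending a partial order to a linear order\<close>

text \<open>The added pairs are exactly those that transitivity forces once \<open>(a, b)\<close>
  joins \<open>r\<close>. A cycle through one of them would yield \<open>(b, a)\<close> in
  \<open>r\<close>.\<close>

lemma partial_order_on_insert_pair:
  assumes "partial_order_on A r" "a \<in> A" "b \<in> A" "(b, a) \<notin> r"
  shows "partial_order_on A (r \<union> {(x, y). (x, a) \<in> r \<and> (b, y) \<in> r})"
    (is "partial_order_on A ?s")
proof -
  have tr: "\<And>x y z. (x, y) \<in> r \<Longrightarrow> (y, z) \<in> r \<Longrightarrow> (x, z) \<in> r"
    and anti: "\<And>x y. (x, y) \<in> r \<Longrightarrow> (y, x) \<in> r \<Longrightarrow> x = y"
    and sub: "r \<subseteq> A \<times> A" and rf: "refl_on A r"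
    using assms(1) by (auto simp: partial_order_on_def preorder_on_def dest: transD antisymD)
  have "?s \<subseteq> A \<times> A" using sub by auto
  moreover have "refl_on A ?s" using rf by (auto simp: refl_on_def)
  moreover have "trans ?s" by (rule transI) (auto intro: tr)
  moreover have "antisym ?s"
  proof (rule antisymI)
    fix x y assume "(x, y) \<in> ?s" "(y, x) \<in> ?s"
    moreover have "(b, y) \<notin> r \<or> (y, a) \<notin> r" for y using assms(4) tr by blast
    ultimately show "x = y" using tr anti by auto
  qed
  ultimately show ?thesis by (simp add: partial_order_on_def preorder_on_def)
qed

lemma partial_order_on_Union_chain:
  assumes "C \<noteq> {}" "subset.chain {r. partial_order_on A r} C"
  shows "partial_order_on A (\<Union>C)"
proof -
  have po: "\<And>r. r \<in> C \<Longrightarrow> partial_order_on A r"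
    using assms(2) by (auto simp: subset_chain_def)
  \<comment> \<open>Transitivity and antisymmetry each concern two pairs at a time, so they can be
    checked inside a single member of the chain.\<close>
  have common: "\<exists>r\<in>C. p \<in> r \<and> q \<in> r" if "p \<in> \<Union>C" "q \<in> \<Union>C" for p q
  proof -
    from that obtain s t where "s \<in> C" "p \<in> s" "t \<in> C" "q \<in> t" by blast
    moreover from this have "s \<subseteq> t \<or> t \<subseteq> s"
      using assms(2) by (auto simp: subset_chain_def)
    ultimately show ?thesis by blast
  qed
  have "\<Union>C \<subseteq> A \<times> A"
    using po by (auto simp: partial_order_on_def preorder_on_def)
  moreover have "refl_on A (\<Union>C)"
    using po assms(1) by (fastforce simp: partial_order_on_def preorder_on_def refl_on_def)
  moreover have "trans (\<Union>C)"
  proof (rule transI)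
    fix x y z assume "(x, y) \<in> \<Union>C" "(y, z) \<in> \<Union>C"
    with common obtain r where "r \<in> C" "(x, y) \<in> r" "(y, z) \<in> r" by blast
    with po have "(x, z) \<in> r"
      by (meson partial_order_on_def preorder_on_def transD)
    with \<open>r \<in> C\<close> show "(x, z) \<in> \<Union>C" by blast
  qed
  moreover have "antisym (\<Union>C)"
  proof (rule antisymI)
    fix x y assume "(x, y) \<in> \<Union>C" "(y, x) \<in> \<Union>C"
    with common obtain r where "r \<in> C" "(x, y) \<in> r" "(y, x) \<in> r" by blast
    with po show "x = y" by (meson partial_order_on_def antisymD)
  qed
  ultimately show ?thesis
    by (simp add: partial_order_on_def preorder_on_def)
qed

text \<open>Szpilrajn's theorem by Zorn's lemma: a maximal partial order above \<open>p\<close> is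
  total, since incomparable \<open>a\<close> and \<open>b\<close> would allow a proper extension
  containing \<open>(a, b)\<close>.\<close>

lemma partial_order_on_extend_linear:
  assumes "partial_order_on A p"
  obtains r where "linear_order_on A r" "p \<subseteq> r"
proof -
  let ?S = "{r. partial_order_on A r \<and> p \<subseteq> r}"
  have "\<exists>r\<in>?S. \<forall>s\<in>?S. r \<subseteq> s \<longrightarrow> s = r"
  proof (rule subset_Zorn_nonempty)
    show "?S \<noteq> {}" using assms by blast
    fix C assume C: "C \<noteq> {}" "subset.chain ?S C"
    then have "subset.chain {r. partial_order_on A r} C"
      by (auto simp: subset_chain_def)
    moreover have "p \<subseteq> \<Union>C"
      using C by (fastforce simp: subset_chain_def)
    ultimately show "\<Union>C \<in> ?S"
      using partial_order_on_Union_chain C(1) by blast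
  qed
  then obtain r where r: "partial_order_on A r" "p \<subseteq> r" and max: "\<forall>s\<in>?S. r \<subseteq> s \<longrightarrow> s = r"
    by auto
  have "(a, b) \<in> r \<or> (b, a) \<in> r" if "a \<in> A" "b \<in> A" for a b
  proof (rule ccontr)
    assume *: "\<not> ((a, b) \<in> r \<or> (b, a) \<in> r)"
    let ?s = "r \<union> {(x, y). (x, a) \<in> r \<and> (b, y) \<in> r}"
    have "partial_order_on A ?s"
      using * that r(1) by (intro partial_order_on_insert_pair) auto
    then have "?s = r"
      using max r(2) by (simp add: subset_iff)
    moreover have "(a, a) \<in> r" "(b, b) \<in> r"
      using r(1) that by (auto simp: partial_order_on_def preorder_on_def refl_on_def)
    ultimately show False using * by blast
  qed
  with r(1) have "linear_order_on A r"
    by (simp add: linear_order_on_def total_on_def)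
  with r(2) that show thesis by blast
qed

text \<open>The pieces are the classes of the equivalence induced on \<open>A\<close> by the
  quasi-order \<open>Q\<close>. Representatives index them, which keeps \<Gamma> in the type of the
  vertices. As \<open>r\<close> extends \<open>Q\<close> on \<Gamma>, a \<open>Q\<close>-step from a
  later piece to an earlier one would contradict antisymmetry of \<open>r\<close>.\<close>

lemma trans_refl_strong_components:
  fixes Q :: "'a rel"
  assumes "trans Q" "refl Q"
  obtains \<Gamma> :: "'a set" and r V where
    "linear_order_on \<Gamma> r" "partition_on A (V ` \<Gamma>)" "inj_on V \<Gamma>"
    "\<And>x u v. x \<in> \<Gamma> \<Longrightarrow> u \<in> V x \<Longrightarrow> v \<in> V x \<Longrightarrow> (u, v) \<in> Q"
    "\<And>x y u v. x \<in> \<Gamma> \<Longrightarrow> y \<in> \<Gamma> \<Longrightarrow> (x, y) \<in> r \<Longrightarrow> x \<noteq> y \<Longrightarrow> u \<in> V y \<Longrightarrow> v \<in> V x \<Longrightarrow> (u, v) \<notin> Q"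
proof -
  have tr: "\<And>x y z. (x, y) \<in> Q \<Longrightarrow> (y, z) \<in> Q \<Longrightarrow> (x, z) \<in> Q" and rf: "\<And>x. (x, x) \<in> Q"
    using assms by (auto dest: transD simp: refl_on_def)
  define V where "V x = {y \<in> A. (x, y) \<in> Q \<and> (y, x) \<in> Q}" for x
  \<comment> \<open>The choice depends on \<open>x\<close> only through the set \<open>V x\<close>,
    so equivalent points get the same representative. This makes \<open>Q\<close> antisymmetric on
    \<Gamma>.\<close>
  define rep where "rep x = (SOME y. y \<in> V x)" for x
  define \<Gamma> where "\<Gamma> = rep ` A"
  have rep: "rep x \<in> V x" if "x \<in> A" for x
    unfolding rep_def by (rule someI[of _ x]) (use that rf in \<open>auto simp: V_def\<close>)
  have V_eq: "V x = V y" if "(x, y) \<in> Q" "(y, x) \<in> Q" for x y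
    using that tr unfolding V_def by blast
  have \<Gamma>A: "\<Gamma> \<subseteq> A" using rep by (auto simp: \<Gamma>_def V_def)
  have anti: "x = y" if xy: "x \<in> \<Gamma>" "y \<in> \<Gamma>" "(x, y) \<in> Q" "(y, x) \<in> Q" for x y
  proof -
    obtain a b where ab: "a \<in> A" "x = rep a" "b \<in> A" "y = rep b"
      using xy unfolding \<Gamma>_def by blast
    then have "x \<in> V a" "y \<in> V b" using rep by blast+
    then have "V x = V a" "V y = V b" using V_eq by (simp_all add: V_def)
    with V_eq[OF xy(3,4)] have "V a = V b" by simp
    with ab show ?thesis by (simp add: rep_def)
  qed
  have "partial_order_on \<Gamma> (Q \<inter> \<Gamma> \<times> \<Gamma>)"
    unfolding partial_order_on_def preorder_on_def
    using anti tr rf by (auto intro!: refl_onI transI antisymI; blast)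
  then obtain r where r: "linear_order_on \<Gamma> r" "Q \<inter> \<Gamma> \<times> \<Gamma> \<subseteq> r"
    using partial_order_on_extend_linear by blast
  have self: "x \<in> V x" if "x \<in> \<Gamma>" for x using that \<Gamma>A rf by (auto simp: V_def)
  have disj: "x = y" if "x \<in> \<Gamma>" "y \<in> \<Gamma>" "z \<in> V x" "z \<in> V y" for x y z
    using that by (intro anti) (auto simp: V_def intro: tr)
  show thesis
  proof (rule that[of \<Gamma> r V])
    show "linear_order_on \<Gamma> r" by (fact r)
    show "inj_on V \<Gamma>" using disj self by (metis inj_onI)
    show "partition_on A (V ` \<Gamma>)"
    proof (rule partition_onI)
      have "x \<in> \<Union>(V ` \<Gamma>)" if "x \<in> A" for x
        using that rep[OF that] by (auto simp: \<Gamma>_def V_def)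
      then show "\<Union>(V ` \<Gamma>) = A" by (auto simp: V_def)
      show "{} \<notin> V ` \<Gamma>" using self by auto
    qed (use disj in \<open>auto simp: disjnt_def\<close>)
    show "(u, v) \<in> Q" if "u \<in> V x" "v \<in> V x" for x u v
      using that tr by (auto simp: V_def)
    show "(u, v) \<notin> Q"
      if "x \<in> \<Gamma>" "y \<in> \<Gamma>" "(x, y) \<in> r" "x \<noteq> y" "u \<in> V y" "v \<in> V x" for x y u v
    proof
      assume "(u, v) \<in> Q"
      then have "(y, x) \<in> Q" using that tr by (simp add: V_def) blast
      with that r have "(y, x) \<in> r" by blast
      with that r(1) show False
        by (auto simp: linear_order_on_def partial_order_on_def dest: antisymD)
    qed
  qed
qed

section \<open>Sets smaller than an infinite cardinal\<close>

lemma cinfinite_card_of_Un_ordLess: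
  assumes "Card_order \<kappa>" "cinfinite \<kappa>" "|A| <o \<kappa>" "|B| <o \<kappa>" "X \<subseteq> A \<union> B"
  shows "|X| <o \<kappa>"
proof (rule ordLeq_ordLess_trans)
  show "|X| \<le>o |A \<union> B|" using assms(5) by (rule card_of_mono1)
  show "|A \<union> B| <o \<kappa>"
    using assms by (simp add: cinfinite_def card_of_Un_ordLess_infinite_Field)
qed

lemma cinfinite_card_of_singleton_ordLess:
  assumes "Card_order \<kappa>" "cinfinite \<kappa>"
  shows "|{x}| <o \<kappa>"
proof -
  have "|{x}| <o |Field \<kappa>|"
    using assms(2)
    by (intro finite_ordLess_infinite) (simp_all add: cinfinite_def Field_card_of card_of_well_order_on)
  then show ?thesis
    using assms(1) card_of_Field_ordIso ordLess_ordIso_trans by blast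
qed

section \<open>Neighbourhoods and reversibility in a tournament\<close>

context tournament
begin

text \<open>Each \<open>w\<close> in the intersection gives a path from \<open>b\<close> through
  \<open>w\<close> to \<open>a\<close>, and different \<open>w\<close> give arc-disjoint
  paths.\<close>

lemma in_out_nbhd_ordLess_if_not_reversible:
  assumes "Card_order \<kappa>" "|pverts D| =o \<kappa>" "a \<noteq> b" "\<not> reversible \<kappa> D a b"
  shows "|in_nbhd D a \<inter> out_nbhd D b| <o \<kappa>"
proof (rule ccontr)
  let ?X = "in_nbhd D a \<inter> out_nbhd D b"
  let ?path = "\<lambda>w. [(b, w), (w, a)]"
  assume "\<not> |?X| <o \<kappa>"
  then have "\<kappa> \<le>o |?X|"
    using not_ordLess_iff_ordLeq[OF card_order_on_well_order_on[OF assms(1)] card_of_Well_order]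
    by blast
  \<comment> \<open>\<open>reversible\<close> asks for a family of size exactly \<kappa>, so
    \<open>?X\<close> must also be bounded from above.\<close>
  moreover have "?X \<subseteq> pverts D"
    by (auto simp: in_nbhd_def dest: in_arcsD1)
  then have "|?X| \<le>o \<kappa>"
    using assms(2) card_of_mono1 ordLeq_ordIso_trans by blast
  ultimately have "|?X| =o \<kappa>" by (simp add: ordIso_iff_ordLeq)
  moreover have "|?path ` ?X| =o |?X|"
    by (rule ordIso_symmetric, rule card_of_ordIsoI[of ?path]) (auto simp: bij_betw_def inj_on_def)
  ultimately have "|?path ` ?X| =o \<kappa>" by (rule ordIso_transitive[rotated])
  moreover have "apath b (?path w) a" if "w \<in> ?X" for w
    using that assms(3) in_arcsD1 in_arcsD2 no_loops'
    by (auto simp: in_nbhd_def out_nbhd_def apath_def awalk_def)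
  \<comment> \<open>A first arc \<open>(b, w)\<close> can equal a second arc \<open>(w', a)\<close>
    only if \<open>w' = b\<close>, which would make \<open>(b, w')\<close> a loop.\<close>
  moreover have "pairwise (\<lambda>p q. set p \<inter> set q = {}) (?path ` ?X)"
    using no_loops' by (auto simp: pairwise_def in_nbhd_def out_nbhd_def)
  ultimately have "reversible \<kappa> D a b"
    unfolding reversible_def by (intro exI[of _ "?path ` ?X"]) auto
  with assms(4) show False ..
qed

text \<open>Differences obey a triangle inclusion: what lies in the first set but not the last is
  lost at some intermediate step, and each step loses fewer than \<kappa> vertices.\<close>

lemma in_nbhd_diff_ordLess_rtrancl:
  assumes "Card_order \<kappa>" "cinfinite \<kappa>" "|pverts D| =o \<kappa>"
    and "(v, w) \<in> {(a, b) \<in> parcs D. \<not> reversible \<kappa> D a b}\<^sup>*"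
  shows "|in_nbhd D v - in_nbhd D w| <o \<kappa>"
  using assms(4)
proof (induction rule: rtrancl_induct)
  case base
  \<comment> \<open>The difference is empty here; covering it by a singleton gives the
    bound.\<close>
  have single: "|{v}| <o \<kappa>"
    using assms(1,2) by (rule cinfinite_card_of_singleton_ordLess)
  show ?case
    by (rule cinfinite_card_of_Un_ordLess[OF assms(1,2) single single]) simp
next
  case (step w x)
  then have wx: "(w, x) \<in> parcs D" "\<not> reversible \<kappa> D w x" by auto
  then have "|in_nbhd D w \<inter> out_nbhd D x| <o \<kappa>"
    using assms in_out_nbhd_ordLess_if_not_reversible no_loops' by blast
  moreover have "in_nbhd D w - in_nbhd D x \<subseteq> in_nbhd D w \<inter> out_nbhd D x \<union> {x}"
    using wx(1) exactly_one_arc by (auto simp: in_nbhd_def out_nbhd_def dest: in_arcsD1 in_arcsD2)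
  ultimately have "|in_nbhd D w - in_nbhd D x| <o \<kappa>"
    by (rule cinfinite_card_of_Un_ordLess[OF assms(1,2) _
          cinfinite_card_of_singleton_ordLess[OF assms(1,2)]])
  with step.IH show ?case
    by (rule cinfinite_card_of_Un_ordLess[OF assms(1,2)]) blast
qed

text \<open>In-neighbourhoods suffice: passing to out-neighbourhoods swaps the two sides of a
  difference, up to one vertex, and the hypothesis covers both orders of \<open>v\<close> and
  \<open>w\<close>.\<close>

lemma uniform_on_if_in_nbhd_diff_ordLess:
  assumes "Card_order \<kappa>" "cinfinite \<kappa>" "A \<subseteq> pverts D"
    and "\<And>v w. v \<in> A \<Longrightarrow> w \<in> A \<Longrightarrow> |in_nbhd D v - in_nbhd D w| <o \<kappa>"
  shows "uniform_on \<kappa> D A"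
proof -
  note Un = cinfinite_card_of_Un_ordLess[OF assms(1,2)]
  have out: "|out_nbhd D v - out_nbhd D w| <o \<kappa>" if "v \<in> A" "w \<in> A" for v w
  proof (rule Un)
    show "|in_nbhd D w - in_nbhd D v| <o \<kappa>" using assms(4) that by blast
    show "|{w}| <o \<kappa>"
      using assms(1,2) by (rule cinfinite_card_of_singleton_ordLess)
    \<comment> \<open>The exception \<open>w\<close> occurs when \<open>(v, w)\<close> is an arc:
      \<open>w\<close> is not in its own out-neighbourhood, nor in its own in-neighbourhood.\<close>
    show "out_nbhd D v - out_nbhd D w \<subseteq> (in_nbhd D w - in_nbhd D v) \<union> {w}"
    proof
      fix x assume "x \<in> out_nbhd D v - out_nbhd D w"
      then have x: "(v, x) \<in> parcs D" "(w, x) \<notin> parcs D"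
        by (auto simp: out_nbhd_def)
      then have "x \<in> pverts D" "v \<in> pverts D" "w \<in> pverts D" "x \<noteq> v"
        using that assms(3) by (auto dest: in_arcsD1 in_arcsD2 no_loops')
      then have "(x, v) \<notin> parcs D" "x = w \<or> (x, w) \<in> parcs D"
        using x exactly_one_arc by blast+
      then show "x \<in> (in_nbhd D w - in_nbhd D v) \<union> {w}"
        by (auto simp: in_nbhd_def)
    qed
  qed
  show ?thesis
    unfolding uniform_on_def
  proof (intro ballI conjI)
    fix v w assume vw: "v \<in> A" "w \<in> A"
    show "|sym_diff (out_nbhd D v) (out_nbhd D w) \<inter> A| <o \<kappa>"
      by (rule Un[OF out[OF vw] out[OF vw(2,1)]]) blast
    show "|sym_diff (in_nbhd D v) (in_nbhd D w) \<inter> A| <o \<kappa>"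
      by (rule Un[OF assms(4)[OF vw] assms(4)[OF vw(2,1)]]) blast
  qed
qed

end

theorem theorem4p1:
  fixes \<kappa> :: "'k rel" and D :: "'a pair_pre_digraph"
  assumes "Card_order \<kappa>" and "cinfinite \<kappa>"
    and "tournament D" and "|pverts D| =o \<kappa>"
  shows "\<exists>(\<Gamma> :: 'a set) r V.
    linear_order_on \<Gamma> r \<and>
    partition_on (pverts D) (V ` \<Gamma>) \<and> inj_on V \<Gamma> \<and>
    (\<forall>x\<in>\<Gamma>. uniform_on \<kappa> D (V x)) \<and>
    (\<forall>x\<in>\<Gamma>. \<forall>y\<in>\<Gamma>. \<forall>u\<in>V y. \<forall>v\<in>V x.
       (x, y) \<in> r \<and> x \<noteq> y \<and> (u, v) \<in> parcs D \<longrightarrow> reversible \<kappa> D u v)"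
proof -
  interpret tournament D by fact
  let ?R = "{(a, b) \<in> parcs D. \<not> reversible \<kappa> D a b}"
  show ?thesis
  proof (rule trans_refl_strong_components[of "?R\<^sup>*" "pverts D", OF trans_rtrancl refl_rtrancl])
    fix \<Gamma> :: "'a set" and r V
    assume *:
      "linear_order_on \<Gamma> r" "partition_on (pverts D) (V ` \<Gamma>)" "inj_on V \<Gamma>"
      "\<And>x u v. x \<in> \<Gamma> \<Longrightarrow> u \<in> V x \<Longrightarrow> v \<in> V x \<Longrightarrow> (u, v) \<in> ?R\<^sup>*"
      "\<And>x y u v. x \<in> \<Gamma> \<Longrightarrow> y \<in> \<Gamma> \<Longrightarrow> (x, y) \<in> r \<Longrightarrow> x \<noteq> y \<Longrightarrow> u \<in> V y \<Longrightarrow> v \<in> V x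
        \<Longrightarrow> (u, v) \<notin> ?R\<^sup>*"
    have "uniform_on \<kappa> D (V x)" if "x \<in> \<Gamma>" for x
    proof (rule uniform_on_if_in_nbhd_diff_ordLess[OF assms(1,2)])
      show "V x \<subseteq> pverts D" using *(2) that by (auto simp: partition_on_def)
      show "|in_nbhd D v - in_nbhd D w| <o \<kappa>" if "v \<in> V x" "w \<in> V x" for v w
        using *(4)[OF \<open>x \<in> \<Gamma>\<close> that] by (rule in_nbhd_diff_ordLess_rtrancl[OF assms(1,2,4)])
    qed
    moreover have "reversible \<kappa> D u v"
      if "x \<in> \<Gamma>" "y \<in> \<Gamma>" "u \<in> V y" "v \<in> V x" "(x, y) \<in> r" "x \<noteq> y" "(u, v) \<in> parcs D" for x y u v
      \<comment> \<open>A non-reversible arc would itself be one step of \<open>?R\<close>, which is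
        excluded between these pieces.\<close>
      using *(5)[OF that(1,2,5,6,3,4)] that(7) by (auto intro: r_into_rtrancl)
    ultimately show ?thesis
      using *(1-3) by (intro exI[of _ \<Gamma>] exI[of _ r] exI[of _ V]) blast
  qed
qed

end
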